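(* Let $A\in\mathbb{R}^{m\times n}$, $b\in\mathbb{R}^m$, and let $p:\mathbb{R}^n\to(-\infty,+\infty]$ be a polyhedral gauge function. Assume that $0<\lambda_\infty<+\infty$. Then for any $\bar\lambda\in(0,\lambda_\infty)$: (i) for any integer $k\ge 1$, the function $\varphi(\cdot)$ is piecewise $C^k$ in an open interval containing $\bar\lambda$; (ii) every $v\in\partial\varphi(\bar\lambda)$ is positive.
   Context: A gauge function is a nonnegative, positively homogeneous convex function $p$ with $p(0)=0$; $p$ is a proper closed function, and it is polyhedral if its epigraph is a polyhedral convex set. Let $\partial p(0)$ be the subdifferential at the origin and $\lambda_\infty:=\inf\{\nu\ge 0 \mid A^Tb\in\nu\,\partial p(0)\}$. For $\lambda>0$ let $\Omega(\lambda)$ be the solution set of $\min_{x\in\mathbb{R}^n}\{\tfrac12\|Ax-b\|^2+\lambda p(x)\}$ ($\|\cdot\|$ Euclidean). Standing assumption: for every $\lambda>0$ there is $(y,u,x)\in\mathbb{R}^m\times\mathbb{R}^n\times\mathbb{R}^n$ with $x\in\partial p^*(u)$, $y-b+Ax=0$, $A^Ty-\lambda u=0$, where $p^*$ is the Fenchel conjugate. Consequently $\Omega(\lambda)\neq\emptyset$ and $b-Ax(\lambda)$ is the same for all $x(\lambda)\in\Omega(\lambda)$. The value function is $\varphi(\lambda):=\|Ax(\lambda)-b\|$ for any $x(\lambda)\in\Omega(\lambda)$, $\lambda>0$. $\partial\varphi(\bar\lambda)$ denotes the Clarke generalized Jacobian (convex hull of the limits of $\varphi'(\lambda_j)$ with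 $\lambda_j\to\bar\lambda$, $\varphi$ differentiable at $\lambda_j$). A function on an open interval is piecewise $C^k$ if it is continuous and there are finitely many $C^k$ functions on that interval such that at each point the function's value equals the value of at least one of them. *)

theory Defs
  imports "HOL-Analysis.Analysis"
begin

definition ereal_epigraph :: "('a \<Rightarrow> ereal) \<Rightarrow> ('a \<times> real) set" where
  "ereal_epigraph f = {(x, r). f x \<le> ereal r}"

definition gauge_function :: "('a::euclidean_space \<Rightarrow> ereal) \<Rightarrow> bool" where
  "gauge_function p \<longleftrightarrow>
     (\<forall>x. 0 \<le> p x) \<and>
     (\<forall>t x. 0 < t \<longrightarrow> p (t *\<^sub>R x) = ereal t * p x) \<and>
     convex (ereal_epigraph p) \<and>
     p 0 = 0"

definition polyhedral :: "('a::euclidean_space \<Rightarrow> ereal) \<Rightarrow> bool" where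
  "polyhedral p \<longleftrightarrow> polyhedron (ereal_epigraph p)"

definition proper_function :: "('a \<Rightarrow> ereal) \<Rightarrow> bool" where
  "proper_function f \<longleftrightarrow> (\<forall>x. f x \<noteq> -\<infinity>) \<and> (\<exists>x. f x \<noteq> \<infinity>)"

definition closed_function :: "('a::euclidean_space \<Rightarrow> ereal) \<Rightarrow> bool" where
  "closed_function f \<longleftrightarrow> closed (ereal_epigraph f)"

text \<open>Gauge functions are also required to be proper and closed. For a polyhedral gauge
  both properties are automatic.\<close>

lemma gauge_function_proper: "gauge_function p \<Longrightarrow> proper_function p"
proof -
  assume p: "gauge_function p"
  have "p x \<noteq> -\<infinity>" for x
  proof
    assume "p x = -\<infinity>"
    moreover have "0 \<le> p x" using p by (simp add: gauge_function_def)
    ultimately show False by simp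
  qed
  moreover have "p 0 \<noteq> \<infinity>" using p by (simp add: gauge_function_def)
  ultimately show "proper_function p" by (auto simp: proper_function_def)
qed

lemma polyhedral_closed: "polyhedral p \<Longrightarrow> closed_function p"
  unfolding polyhedral_def closed_function_def by (rule polyhedron_imp_closed)

definition subdifferential :: "('a::euclidean_space \<Rightarrow> ereal) \<Rightarrow> 'a \<Rightarrow> 'a set" where
  "subdifferential f x = {v. \<forall>z. f x + ereal (v \<bullet> (z - x)) \<le> f z}"

definition fenchel_conjugate :: "('a::euclidean_space \<Rightarrow> ereal) \<Rightarrow> 'a \<Rightarrow> ereal" where
  "fenchel_conjugate f u = (SUP x. ereal (u \<bullet> x) - f x)"

text \<open>The value is \<open>\<infinity>\<close> when no \<open>\<nu>\<close> is admissible.\<close>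

definition lambda_inf ::
    "real^'n^'m \<Rightarrow> real^'m \<Rightarrow> (real^'n \<Rightarrow> ereal) \<Rightarrow> ereal" where
  "lambda_inf A b p =
     Inf (ereal ` {\<nu>. 0 \<le> \<nu> \<and> transpose A *v b \<in> (\<lambda>v. \<nu> *\<^sub>R v) ` subdifferential p 0})"

definition objective ::
    "real^'n^'m \<Rightarrow> real^'m \<Rightarrow> (real^'n \<Rightarrow> ereal) \<Rightarrow> real \<Rightarrow> real^'n \<Rightarrow> ereal" where
  "objective A b p lam x = ereal (1/2 * (norm (A *v x - b))\<^sup>2) + ereal lam * p x"

definition solution_set ::
    "real^'n^'m \<Rightarrow> real^'m \<Rightarrow> (real^'n \<Rightarrow> ereal) \<Rightarrow> real \<Rightarrow> (real^'n) set" where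
  "solution_set A b p lam = {x. is_arg_min (objective A b p lam) (\<lambda>_. True) x}"

definition value_function ::
    "real^'n^'m \<Rightarrow> real^'m \<Rightarrow> (real^'n \<Rightarrow> ereal) \<Rightarrow> real \<Rightarrow> real" where
  "value_function A b p lam = (THE r. \<exists>x\<in>solution_set A b p lam. r = norm (A *v x - b))"

text \<open>The description in the previous definition is unambiguous: the residual does not depend
  on the chosen minimizer.\<close>

lemma solution_residual_unique:
  fixes A :: "real^'n^'m"
  assumes p: "gauge_function p" and l: "0 < lam"
    and x: "x \<in> solution_set A b p lam" and y: "y \<in> solution_set A b p lam"
  shows "A *v x = A *v y"
proof -
  let ?F = "objective A b p lam"
  have min: "?F w \<le> ?F z" if "w \<in> solution_set A b p lam" for w z
    using that by (auto simp: solution_set_def is_arg_min_linorder)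
  have fin: "\<exists>a. p w = ereal a" if "w \<in> solution_set A b p lam" for w
  proof -
    have "?F w \<le> ?F 0" using min[OF that] .
    moreover have "p 0 = 0" "0 \<le> p w" using p by (auto simp: gauge_function_def)
    ultimately show ?thesis using l by (cases "p w") (auto simp: objective_def)
  qed
  obtain a c where a: "p x = ereal a" and c: "p y = ereal c" using fin x y by metis
  define z where "z = (1/2) *\<^sub>R x + (1/2) *\<^sub>R y"
  have "(1/2) *\<^sub>R (x, a) + (1/2) *\<^sub>R (y, c) \<in> ereal_epigraph p"
    using p a c by (intro convexD) (auto simp: gauge_function_def ereal_epigraph_def)
  then have pz: "p z \<le> ereal ((a + c) / 2)"
    by (simp add: ereal_epigraph_def z_def add_divide_distrib)
  moreover have "0 \<le> p z" using p by (auto simp: gauge_function_def)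
  ultimately obtain d where d: "p z = ereal d" "d \<le> (a + c) / 2"
    by (cases "p z") auto
  have arith: "D \<le> 0"
    if "lam * d \<le> (lam * a + lam * c) / 2" "W = (P + Q) / 2 - D / 4"
      "P / 2 + lam * a \<le> W / 2 + lam * d" "Q / 2 + lam * c \<le> W / 2 + lam * d"
    for W P Q D :: real
    using that by argo
  define X where "X = A *v x - b"
  define Y where "Y = A *v y - b"
  have Z: "A *v z - b = (1/2) *\<^sub>R (X + Y)"
    by (simp add: z_def X_def Y_def matrix_vector_right_distrib matrix_vector_mult_scaleR
        scaleR_right_distrib scaleR_right_diff_distrib)
  have "?F x \<le> ?F z" "?F y \<le> ?F z" using min x y by auto
  then have 1: "(norm X)\<^sup>2 / 2 + lam * a \<le> (norm ((1/2) *\<^sub>R (X + Y)))\<^sup>2 / 2 + lam * d"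
    and 2: "(norm Y)\<^sup>2 / 2 + lam * c \<le> (norm ((1/2) *\<^sub>R (X + Y)))\<^sup>2 / 2 + lam * d"
    using a c d Z by (auto simp: objective_def X_def Y_def)
  have "lam * d \<le> lam * ((a + c) / 2)" using d l by (intro mult_left_mono) auto
  then have "lam * d \<le> (lam * a + lam * c) / 2" by (simp add: algebra_simps)
  moreover have "(norm ((1/2) *\<^sub>R (X + Y)))\<^sup>2 = ((norm X)\<^sup>2 + (norm Y)\<^sup>2) / 2 - (norm (X - Y))\<^sup>2 / 4"
    unfolding power2_norm_eq_inner
    by (simp add: inner_add_left inner_add_right inner_diff_left inner_diff_right
        inner_commute field_simps)
  ultimately have "(norm (X - Y))\<^sup>2 \<le> 0"
    using 1 2 arith by blast
  then show ?thesis by (simp add: X_def Y_def)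
qed

lemma value_function_eq:
  assumes "gauge_function p" "0 < lam" "x \<in> solution_set A b p lam"
  shows "value_function A b p lam = norm (A *v x - b)"
  unfolding value_function_def
proof (rule the_equality)
  fix r assume "\<exists>x'\<in>solution_set A b p lam. r = norm (A *v x' - b)"
  then obtain x' where x': "x' \<in> solution_set A b p lam" "r = norm (A *v x' - b)" ..
  show "r = norm (A *v x - b)"
    unfolding x'(2) solution_residual_unique[OF assms(1,2) x'(1) assms(3)] ..
qed (use assms(3) in blast)

text \<open>For functions of one real variable. The sequence need not avoid \<open>x\<close> itself.\<close>

definition clarke_jacobian :: "(real \<Rightarrow> real) \<Rightarrow> real \<Rightarrow> real set" where
  "clarke_jacobian f x =
     convex hull {v. \<exists>s d. s \<longlonglongrightarrow> x \<and>
                          (\<forall>j. (f has_real_derivative d j) (at (s j))) \<and>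
                          d \<longlonglongrightarrow> v}"

text \<open>Intended for open \<open>S\<close>: derivatives are two-sided.\<close>

primrec Ck_on :: "nat \<Rightarrow> (real \<Rightarrow> real) \<Rightarrow> real set \<Rightarrow> bool" where
  "Ck_on 0 f S \<longleftrightarrow> continuous_on S f"
| "Ck_on (Suc k) f S \<longleftrightarrow>
     (\<exists>f'. (\<forall>x\<in>S. (f has_real_derivative f' x) (at x)) \<and> Ck_on k f' S)"

definition piecewise_Ck_on :: "nat \<Rightarrow> (real \<Rightarrow> real) \<Rightarrow> real set \<Rightarrow> bool" where
  "piecewise_Ck_on k f S \<longleftrightarrow>
     continuous_on S f \<and>
     (\<exists>G. finite G \<and> (\<forall>g\<in>G. Ck_on k g S) \<and> (\<forall>x\<in>S. \<exists>g\<in>G. f x = g x))"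

end

theory Submission
  imports Defs
begin

text \<open>Write \<open>Q = \<partial>p(0)\<close> and let \<open>y(\<lambda>) = b - A x(\<lambda>)\<close> be the residual of a solution, so that
  \<open>\<phi>(\<lambda>) = \<parallel>y(\<lambda>)\<parallel>\<close>. Optimality of \<open>x(\<lambda>)\<close> is equivalent to the existence of \<open>u \<in> Q\<close> with
  \<open>A\<^sup>T y = \<lambda> u\<close> and \<open>p(x) = \<langle>u, x\<rangle>\<close>; such a triple \<open>(y, u, x)\<close> is called a certificate below.
  Geometrically, \<open>y(\<lambda>)\<close> is the projection of \<open>b\<close> onto \<open>\<lambda>C\<close>, where \<open>C = {z. A\<^sup>T z \<in> Q}\<close>, and the
  variational inequality of this projection is \<open>certificate_variational\<close>.

  Piecewise smoothness uses that \<open>p\<close> is polyhedral. Since \<open>u \<in> Q\<close>, the hyperplane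
  \<open>r = \<langle>u, z\<rangle>\<close> cuts a face out of the epigraph of \<open>p\<close> (\<open>contact_face\<close>), and the epigraph has only
  finitely many faces. Among the parameters that give the same face, \<open>y\<close> is an affine function of
  \<open>\<lambda>\<close> (\<open>certificate_affine\<close>). Hence \<open>\<phi>\<close> is a continuous selection of finitely many functions
  \<open>\<parallel>c + \<lambda> d\<parallel>\<close>. Such a function is smooth where it does not vanish, and those that vanish at the base
  point cannot be active near it, because \<open>\<phi>\<close> is continuous and positive there.

  Positivity of the Clarke derivatives holds without polyhedrality. Let \<open>\<lambda> < \<mu>\<close>. The
  variational inequalities at \<open>\<lambda>\<close> and \<open>\<mu>\<close>, tested with each other, show that \<open>y\<close> is locally
  Lipschitz and that \<open>\<parallel>y(\<mu>) - y(\<lambda>)\<parallel>\<^sup>2\<close> controls the growth of \<open>\<phi>\<close> from below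
  (\<open>certificate_increment\<close>). Because \<open>b \<in> \<nu>C\<close> for some finite \<open>\<nu>\<close> while \<open>b \<notin> \<mu>C\<close> for
  \<open>\<mu> < \<lambda>\<^sub>\<infinity>\<close>, the residual moves at a speed bounded away from zero. Together this gives
  \<open>\<phi>(\<mu>) - \<phi>(\<lambda>) \<ge> \<gamma> (\<mu> - \<lambda>)\<close> near the base point with some \<open>\<gamma> > 0\<close>
  (\<open>certificate_growth\<close>), so every Clarke derivative is at least \<open>\<gamma>\<close>.\<close>

section \<open>Smoothness of the norm along an affine curve\<close>

lemma Ck_on_cong:
  assumes "open S" and "\<And>x. x \<in> S \<Longrightarrow> f x = g x"
  shows "Ck_on k f S \<longleftrightarrow> Ck_on k g S"
proof (cases k)
  case 0
  then show ?thesis using assms(2) by (auto cong: continuous_on_cong)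
next
  case (Suc j)
  have "(f has_real_derivative D) (at x) \<longleftrightarrow> (g has_real_derivative D) (at x)"
    if "x \<in> S" for x D
  proof (rule DERIV_cong_ev)
    show "\<forall>\<^sub>F y in nhds x. f y = g y"
      using assms that by (auto simp: eventually_nhds)
  qed auto
  then show ?thesis by (simp add: Suc)
qed

text \<open>This class of functions is closed under differentiation, which carries the induction on the
  order of smoothness.\<close>

lemma Ck_on_poly_times_powr:
  fixes P Q :: "real poly"
  assumes pos: "\<And>x. x \<in> S \<Longrightarrow> 0 < poly Q x"
  shows "Ck_on k (\<lambda>x. poly P x * poly Q x powr a) S"
proof (induction k arbitrary: P a)
  case 0
  have "poly Q x \<noteq> 0" if "x \<in> S" for x using pos[OF that] by simp
  then show ?case by (auto intro!: continuous_intros)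
next
  case (Suc k)
  define R where "R = pderiv P * Q + smult a (P * pderiv Q)"
  have "((\<lambda>x. poly P x * poly Q x powr a) has_real_derivative
      poly R x * poly Q x powr (a - 1)) (at x)" if "x \<in> S" for x
  proof -
    have split: "poly Q x powr a = poly Q x * poly Q x powr (a - 1)"
      using pos[OF that] by (simp add: powr_diff)
    have "((\<lambda>x. poly P x * poly Q x powr a) has_real_derivative
        poly (pderiv P) x * poly Q x powr a
          + a * poly Q x powr (a - 1) * poly (pderiv Q) x * poly P x) (at x)"
      using DERIV_mult[OF poly_DERIV[of P x] DERIV_fun_powr[OF poly_DERIV[of Q x] pos[OF that], of a]]
      by (simp add: ac_simps)
    then show ?thesis
      unfolding split by (simp add: R_def algebra_simps)
  qed
  then show ?case
    using Suc.IH[of R "a - 1"]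
    by (auto intro!: exI[of _ "\<lambda>x. poly R x * poly Q x powr (a - 1)"])
qed

lemma Ck_on_norm_affine:
  fixes c d :: "'a::real_inner"
  assumes "open S" and nz: "\<And>t. t \<in> S \<Longrightarrow> c + t *\<^sub>R d \<noteq> 0"
  shows "Ck_on k (\<lambda>t. norm (c + t *\<^sub>R d)) S"
proof -
  define Q where "Q = [:c \<bullet> c, 2 * (c \<bullet> d), d \<bullet> d:]"
  have Q: "poly Q t = (norm (c + t *\<^sub>R d))\<^sup>2" for t
    unfolding power2_norm_eq_inner Q_def
    by (simp add: inner_add_left inner_add_right inner_commute algebra_simps)
  have "Ck_on k (\<lambda>t. poly 1 t * poly Q t powr (1/2)) S"
    by (rule Ck_on_poly_times_powr) (use nz in \<open>simp add: Q\<close>)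
  also have "?this \<longleftrightarrow> ?thesis"
    by (rule Ck_on_cong) (use assms in \<open>auto simp: Q powr_half_sqrt\<close>)
  finally show ?thesis .
qed

section \<open>Support function representation of a closed gauge\<close>

lemma subdifferential_gauge_0:
  assumes "gauge_function p"
  shows "v \<in> subdifferential p 0 \<longleftrightarrow> (\<forall>z. ereal (v \<bullet> z) \<le> p z)"
  using assms by (simp add: subdifferential_def gauge_function_def)

text \<open>The conjugate of a gauge \<open>p\<close> is the indicator function of \<open>\<partial>p(0)\<close>, so its subgradients at
  \<open>u\<close> are the normal vectors to \<open>\<partial>p(0)\<close> at \<open>u\<close>.\<close>

lemma subgradient_conjugate_gauge:
  fixes u x :: "'a::euclidean_space"
  assumes p: "gauge_function p"
    and x: "x \<in> subdifferential (fenchel_conjugate p) u"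
  shows "u \<in> subdifferential p 0"
    and "\<And>w. w \<in> subdifferential p 0 \<Longrightarrow> w \<bullet> x \<le> u \<bullet> x"
proof -
  have p0: "p 0 = 0" and pge: "0 \<le> p z" for z
    using p by (auto simp: gauge_function_def)
  have le0: "fenchel_conjugate p w \<le> 0" if "w \<in> subdifferential p 0" for w
    unfolding fenchel_conjugate_def
  proof (rule SUP_least)
    fix z
    have "ereal (w \<bullet> z) \<le> p z" using that subdifferential_gauge_0[OF p] by blast
    then show "ereal (w \<bullet> z) - p z \<le> 0" by (cases "p z") auto
  qed
  have ge: "ereal (w \<bullet> z) - p z \<le> fenchel_conjugate p w" for w z
    unfolding fenchel_conjugate_def by (rule SUP_upper) simp
  have sub: "fenchel_conjugate p u + ereal (x \<bullet> (w - u)) \<le> fenchel_conjugate p w" for w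
    using x by (simp add: subdifferential_def)
  have ge0: "0 \<le> fenchel_conjugate p u" using ge[of u 0] p0 by (simp add: zero_ereal_def)
  have "0 \<in> subdifferential p 0" using pge by (simp add: subdifferential_gauge_0[OF p] zero_ereal_def[symmetric])
  then have "fenchel_conjugate p u + ereal (x \<bullet> (0 - u)) \<le> 0"
    using sub[of 0] le0[of 0] by (meson order_trans)
  then have bound: "fenchel_conjugate p u \<le> ereal (x \<bullet> u)"
    using ge0 by (cases "fenchel_conjugate p u") (auto simp: zero_ereal_def)
  show u: "u \<in> subdifferential p 0"
    unfolding subdifferential_gauge_0[OF p]
  proof (rule allI, rule ccontr)
    fix z assume "\<not> ereal (u \<bullet> z) \<le> p z"
    then obtain r where r: "p z = ereal r" "r < u \<bullet> z"
      using pge[of z] by (cases "p z") auto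
    \<comment> \<open>A violated inequality would make the conjugate unbounded along the ray through \<open>z\<close>.\<close>
    define t where "t = (\<bar>x \<bullet> u\<bar> + 1) / (u \<bullet> z - r)"
    have t: "0 < t" unfolding t_def using r(2) by (intro divide_pos_pos) auto
    then have "p (t *\<^sub>R z) = ereal (t * r)" using p r(1) by (auto simp: gauge_function_def)
    then have "ereal (t * (u \<bullet> z - r)) \<le> fenchel_conjugate p u"
      using ge[of u "t *\<^sub>R z"] by (simp add: algebra_simps)
    then have "ereal (t * (u \<bullet> z - r)) \<le> ereal (x \<bullet> u)" using bound order_trans by blast
    moreover have "t * (u \<bullet> z - r) = \<bar>x \<bullet> u\<bar> + 1" using r(2) by (simp add: t_def)
    ultimately show False by simp
  qed
  show "w \<bullet> x \<le> u \<bullet> x" if "w \<in> subdifferential p 0" for w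
  proof -
    have "fenchel_conjugate p u + ereal (x \<bullet> (w - u)) \<le> 0"
      using sub[of w] le0[OF that] by (meson order_trans)
    moreover have "ereal (x \<bullet> (w - u)) \<le> fenchel_conjugate p u + ereal (x \<bullet> (w - u))"
      using add_right_mono[OF ge0, of "ereal (x \<bullet> (w - u))"] by simp
    ultimately have "ereal (x \<bullet> (w - u)) \<le> 0" by (meson order_trans)
    then show ?thesis by (simp add: inner_diff_right inner_commute zero_ereal_def)
  qed
qed

text \<open>A closed gauge is the support function of \<open>\<partial>p(0)\<close>. This is stated for a maximizer \<open>u\<close> of
  \<open>w \<mapsto> \<langle>w, x\<rangle>\<close> over \<open>\<partial>p(0)\<close>.\<close>

lemma gauge_eq_support:
  fixes u x :: "'a::euclidean_space"
  assumes p: "gauge_function p" and cl: "closed_function p"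
    and u: "u \<in> subdifferential p 0"
    and max: "\<And>w. w \<in> subdifferential p 0 \<Longrightarrow> w \<bullet> x \<le> u \<bullet> x"
  shows "p x = ereal (u \<bullet> x)"
proof (rule antisym)
  have p0: "p 0 = 0" and pge: "0 \<le> p z" for z
    using p by (auto simp: gauge_function_def)
  have uz: "ereal (u \<bullet> z) \<le> p z" for z
    using u subdifferential_gauge_0[OF p] by blast
  show "ereal (u \<bullet> x) \<le> p x" by (rule uz)
  show "p x \<le> ereal (u \<bullet> x)"
  proof (rule ccontr)
    assume "\<not> p x \<le> ereal (u \<bullet> x)"
    then have "(x, u \<bullet> x) \<notin> ereal_epigraph p" by (simp add: ereal_epigraph_def)
    then obtain a \<beta> where sep: "a \<bullet> (x, u \<bullet> x) < \<beta>" "\<And>e. e \<in> ereal_epigraph p \<Longrightarrow> \<beta> < a \<bullet> e"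
      using separating_hyperplane_closed_point[of "ereal_epigraph p" "(x, u \<bullet> x)"] p cl
      unfolding gauge_function_def closed_function_def by blast
    obtain w s where a: "a = (w, s)" by (cases a)
    have \<beta>: "\<beta> < 0"
      using sep(2)[of "(0, 0)"] p0 by (simp add: a ereal_epigraph_def zero_ereal_def)
    have cone: "0 \<le> w \<bullet> z + s * r" if zr: "p z \<le> ereal r" for z r
    proof (rule ccontr)
      assume "\<not> 0 \<le> w \<bullet> z + s * r"
      then have neg: "w \<bullet> z + s * r < 0" by simp
      define t where "t = \<beta> / (w \<bullet> z + s * r)"
      have t: "0 < t" using neg \<beta> by (simp add: t_def divide_neg_neg)
      obtain q where q: "p z = ereal q" "q \<le> r" using zr pge[of z] by (cases "p z") auto
      have "p (t *\<^sub>R z) = ereal (t * q)" using p t q(1) by (auto simp: gauge_function_def)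
      then have "(t *\<^sub>R z, t * r) \<in> ereal_epigraph p" using t q(2) by (simp add: ereal_epigraph_def)
      from sep(2)[OF this] have "\<beta> < t * (w \<bullet> z + s * r)" by (simp add: a algebra_simps)
      then show False using neg by (simp add: t_def)
    qed
    have s0: "0 \<le> s" using cone[of 0 1] p0 by (simp add: zero_ereal_def one_ereal_def)
    have wx: "w \<bullet> x + s * (u \<bullet> x) < 0" using sep(1) \<beta> by (simp add: a)
    \<comment> \<open>The separating hyperplane may be vertical, that is \<open>s = 0\<close>, in which case there is no
      subgradient \<open>- w / s\<close>. Averaging with \<open>u\<close> covers both cases: \<open>v\<close> lies in \<open>\<partial>p(0)\<close> and
      has a larger product with \<open>x\<close> than \<open>u\<close>.\<close>
    define v where "v = (1 / (1 + s)) *\<^sub>R (u - w)"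
    have "v \<in> subdifferential p 0"
      unfolding subdifferential_gauge_0[OF p]
    proof
      fix z
      show "ereal (v \<bullet> z) \<le> p z"
      proof (cases "p z")
        case (real r)
        have "u \<bullet> z \<le> r" using uz[of z] real by simp
        moreover have "0 \<le> w \<bullet> z + s * r" using cone real by simp
        ultimately have "(u - w) \<bullet> z \<le> (1 + s) * r" by (simp add: algebra_simps inner_diff_left)
        then show ?thesis using s0 real by (simp add: v_def divide_le_eq mult.commute)
      qed (use pge[of z] in auto)
    qed
    then have "v \<bullet> x \<le> u \<bullet> x" by (rule max)
    then have "(u - w) \<bullet> x \<le> (1 + s) * (u \<bullet> x)" using s0 by (simp add: v_def divide_le_eq mult.commute)
    then show False using wx by (simp add: algebra_simps inner_diff_left)
  qed
qed

section \<open>Primal-dual certificates\<close>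

text \<open>The optimality conditions of the penalized least squares problem with parameter \<open>lam\<close>: \<open>y\<close> is
  the residual of the primal point \<open>x\<close>, and \<open>u\<close> is a subgradient of \<open>p\<close> at \<open>x\<close>. For a gauge, the
  latter means that \<open>u \<in> \<partial>p(0)\<close> and \<open>p(x) = \<langle>u, x\<rangle>\<close>.\<close>

definition certificate ::
    "real^'n^'m \<Rightarrow> real^'m \<Rightarrow> (real^'n \<Rightarrow> ereal) \<Rightarrow> real \<Rightarrow> real^'m \<Rightarrow> real^'n \<Rightarrow> real^'n \<Rightarrow> bool" where
  "certificate A b p lam y u x \<longleftrightarrow>
     u \<in> subdifferential p 0 \<and> p x = ereal (u \<bullet> x) \<and>
     y = b - A *v x \<and> transpose A *v y = lam *\<^sub>R u"

lemma certificate_of_optimality_system: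
  fixes A :: "real^'n^'m"
  assumes "gauge_function p" and "polyhedral p"
    and "x \<in> subdifferential (fenchel_conjugate p) u"
    and "y - b + A *v x = 0" and "transpose A *v y - lam *\<^sub>R u = 0"
  shows "certificate A b p lam y u x"
  unfolding certificate_def
proof (intro conjI)
  note sub = subgradient_conjugate_gauge[OF assms(1,3)]
  show "u \<in> subdifferential p 0" by (rule sub)
  show "p x = ereal (u \<bullet> x)"
    by (rule gauge_eq_support[OF assms(1) polyhedral_closed[OF assms(2)] sub])
  show "y = b - A *v x" using assms(4) by (simp add: algebra_simps eq_neg_iff_add_eq_0)
  show "transpose A *v y = lam *\<^sub>R u" using assms(5) by simp
qed

lemma certificate_solution:
  fixes A :: "real^'n^'m"
  assumes p: "gauge_function p" and l: "0 < lam" and cert: "certificate A b p lam y u x"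
  shows "x \<in> solution_set A b p lam"
proof -
  have u: "\<And>z. ereal (u \<bullet> z) \<le> p z" and px: "p x = ereal (u \<bullet> x)"
    and y: "y = b - A *v x" and Ay: "transpose A *v y = lam *\<^sub>R u"
    using cert subdifferential_gauge_0[OF p] by (auto simp: certificate_def)
  have "objective A b p lam x \<le> objective A b p lam z" for z
  proof (cases "p z")
    case (real r)
    have "u \<bullet> z \<le> r" using u[of z] real by simp
    then have 1: "lam * (u \<bullet> z) \<le> lam * r" using l by simp
    define h where "h = A *v z - A *v x"
    have "y \<bullet> h = lam * (u \<bullet> z) - lam * (u \<bullet> x)"
      unfolding h_def matrix_vector_mult_diff_distrib[symmetric]
      using Ay dot_lmul_matrix[of y A "z - x"]
      by (simp add: inner_diff_right algebra_simps)
    moreover have "(norm (A *v z - b))\<^sup>2 = (norm y)\<^sup>2 - 2 * (y \<bullet> h) + (norm h)\<^sup>2"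
    proof -
      have "A *v z - b = h - y" by (simp add: h_def y)
      then show ?thesis by (simp add: power2_norm_eq_inner inner_diff_left inner_diff_right inner_commute)
    qed
    moreover have "(norm (A *v x - b))\<^sup>2 = (norm y)\<^sup>2" by (simp add: y norm_minus_commute)
    ultimately have "1/2 * (norm (A *v x - b))\<^sup>2 + lam * (u \<bullet> x) \<le> 1/2 * (norm (A *v z - b))\<^sup>2 + lam * r"
      using 1 zero_le_power2[of "norm h"] by linarith
    then show ?thesis by (simp add: objective_def px real)
  next
    case PInf
    then show ?thesis using l by (simp add: objective_def)
  next
    case MInf
    then show ?thesis using u[of z] by simp
  qed
  then show ?thesis by (simp add: solution_set_def is_arg_min_linorder)
qed

lemma certificate_value:
  fixes A :: "real^'n^'m"
  assumes "gauge_function p" "0 < lam" "certificate A b p lam y u x"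
  shows "value_function A b p lam = norm y"
  using value_function_eq[OF assms(1,2) certificate_solution[OF assms]] assms(3)
  by (simp add: certificate_def norm_minus_commute)

lemma certificate_inner:
  fixes A :: "real^'n^'m"
  assumes "certificate A b p lam y u x" and "transpose A *v z = \<nu> *\<^sub>R w"
  shows "(b - y) \<bullet> z = \<nu> * (w \<bullet> x)"
proof -
  have "(b - y) \<bullet> z = z \<bullet> (A *v x)" using assms(1) by (simp add: certificate_def inner_commute)
  also have "\<dots> = (transpose A *v z) \<bullet> x" using dot_lmul_matrix[of z A x] by simp
  finally show ?thesis using assms(2) by simp
qed

text \<open>The variational inequality of the projection of \<open>b\<close> onto \<open>lam C\<close>, where
  \<open>C = {z. A\<^sup>T z \<in> \<partial>p(0)}\<close>: for a test point \<open>z \<in> \<nu>C\<close>, both sides are multiplied by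
  \<open>\<nu>\<close> so that no division is needed.\<close>

lemma certificate_variational:
  fixes A :: "real^'n^'m"
  assumes p: "gauge_function p" and cert: "certificate A b p lam y u x"
    and l: "0 \<le> lam" and nu: "0 \<le> \<nu>" and w: "w \<in> subdifferential p 0"
    and z: "transpose A *v z = \<nu> *\<^sub>R w"
  shows "lam * ((b - y) \<bullet> z) \<le> \<nu> * ((b - y) \<bullet> y)"
proof -
  have "ereal (w \<bullet> x) \<le> p x" using w subdifferential_gauge_0[OF p] by blast
  then have "w \<bullet> x \<le> u \<bullet> x" using cert by (simp add: certificate_def)
  moreover have "(b - y) \<bullet> y = lam * (u \<bullet> x)"
    using certificate_inner[OF cert] cert by (auto simp: certificate_def)
  ultimately show ?thesis
    using certificate_inner[OF cert z] l nu by (simp add: mult_left_mono mult.left_commute)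
qed

section \<open>Growth of the residual\<close>

lemma certificate_inner_nonneg:
  fixes A :: "real^'n^'m"
  assumes p: "gauge_function p" and cert: "certificate A b p lam y u x" and l: "0 \<le> lam"
  shows "0 \<le> (b - y) \<bullet> y"
proof -
  have "0 \<le> u \<bullet> x"
    using p cert unfolding certificate_def gauge_function_def by (metis ereal_less_eq(5))
  then show ?thesis
    using certificate_inner[OF cert] cert l by (auto simp: certificate_def)
qed

lemma certificate_norm_le:
  fixes A :: "real^'n^'m"
  assumes "gauge_function p" and "certificate A b p lam y u x" and "0 \<le> lam"
  shows "norm y \<le> norm b"
proof -
  have "norm y * norm y \<le> b \<bullet> y"
    using certificate_inner_nonneg[OF assms]
    by (simp add: inner_diff_left power2_norm_eq_inner[symmetric] power2_eq_square)
  also have "\<dots> \<le> norm b * norm y" by (rule norm_cauchy_schwarz)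
  finally show ?thesis by (cases "y = 0") auto
qed

lemma certificate_increment:
  fixes A :: "real^'n^'m"
  assumes p: "gauge_function p" and l: "0 < lam" and m: "lam < mu"
    and cert: "certificate A b p lam y u x" and cert': "certificate A b p mu y' u' x'"
  shows "lam * (norm (y' - y))\<^sup>2 \<le> (mu - lam) * ((y' - y) \<bullet> y)"
proof -
  have "lam * ((b - y) \<bullet> y') \<le> mu * ((b - y) \<bullet> y)"
    by (rule certificate_variational[OF p cert, where w = u'])
      (use l m cert' in \<open>auto simp: certificate_def\<close>)
  moreover have "mu * ((b - y') \<bullet> y) \<le> lam * ((b - y') \<bullet> y')"
    by (rule certificate_variational[OF p cert', where w = u])
      (use l m cert in \<open>auto simp: certificate_def\<close>)
  ultimately show ?thesis
    by (simp add: power2_norm_eq_inner inner_diff_left inner_diff_right inner_commute algebra_simps)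
qed

lemma certificate_lipschitz:
  fixes A :: "real^'n^'m"
  assumes p: "gauge_function p" and l: "0 < lam" and m: "lam < mu"
    and cert: "certificate A b p lam y u x" and cert': "certificate A b p mu y' u' x'"
  shows "lam * norm (y' - y) \<le> norm b * (mu - lam)"
proof (cases "y' = y")
  case True
  then show ?thesis using m by simp
next
  case False
  have "lam * (norm (y' - y))\<^sup>2 \<le> (mu - lam) * ((y' - y) \<bullet> y)"
    by (rule certificate_increment[OF assms])
  also have "\<dots> \<le> (mu - lam) * (norm (y' - y) * norm b)"
    using m certificate_norm_le[OF p cert] l
    by (intro mult_left_mono order_trans[OF norm_cauchy_schwarz]) auto
  finally have "norm (y' - y) * (lam * norm (y' - y)) \<le> norm (y' - y) * (norm b * (mu - lam))"
    by (simp add: power2_eq_square algebra_simps)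
  then show ?thesis using False by simp
qed

lemma certificate_distance_antimono:
  fixes A :: "real^'n^'m"
  assumes p: "gauge_function p" and l: "0 < lam" and m: "lam < mu"
    and cert: "certificate A b p lam y u x" and cert': "certificate A b p mu y' u' x'"
  shows "norm (b - y') \<le> norm (b - y)"
proof -
  have "mu * ((b - y') \<bullet> y) \<le> lam * ((b - y') \<bullet> y')"
    by (rule certificate_variational[OF p cert', where w = u])
      (use l m cert in \<open>auto simp: certificate_def\<close>)
  also have "\<dots> \<le> mu * ((b - y') \<bullet> y')"
    using certificate_inner_nonneg[OF p cert'] l m by (intro mult_right_mono) auto
  finally have "(b - y') \<bullet> y \<le> (b - y') \<bullet> y'" using l m by simp
  then have "(b - y') \<bullet> (b - y') \<le> (b - y') \<bullet> (b - y)" by (simp add: inner_diff_right)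
  also have "\<dots> \<le> norm (b - y') * norm (b - y)" by (rule norm_cauchy_schwarz)
  finally have "norm (b - y') * norm (b - y') \<le> norm (b - y') * norm (b - y)"
    by (simp add: power2_norm_eq_inner[symmetric] power2_eq_square)
  then show ?thesis by (cases "b = y'") auto
qed

text \<open>If \<open>b\<close> itself belongs to \<open>\<nu>C\<close>, it can serve as the test point; this bounds
  \<open>\<langle>b - y, y\<rangle>\<close> from below by the squared distance of \<open>b\<close> to \<open>lam C\<close>.\<close>

lemma certificate_inner_lower:
  fixes A :: "real^'n^'m"
  assumes p: "gauge_function p" and l: "0 < lam" and nu: "lam < \<nu>"
    and cert: "certificate A b p lam y u x"
    and w: "w \<in> subdifferential p 0" and b: "transpose A *v b = \<nu> *\<^sub>R w"
  shows "lam * (norm (b - y))\<^sup>2 \<le> \<nu> * ((b - y) \<bullet> y)"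
proof -
  have "lam * ((b - y) \<bullet> b) \<le> \<nu> * ((b - y) \<bullet> y)"
    by (rule certificate_variational[OF p cert _ _ w b]) (use l nu in auto)
  moreover have "0 \<le> lam * ((b - y) \<bullet> y)" 
    using certificate_inner_nonneg[OF p cert] l by simp
  ultimately show ?thesis
    by (simp add: power2_norm_eq_inner inner_diff_left inner_diff_right inner_commute algebra_simps)
qed

text \<open>The quantitative strict monotonicity of \<open>\<phi>\<close>. The speed of the residual is at least \<open>\<kappa>\<close>,
  because the variational inequality at \<open>mu\<close> tested with \<open>y\<close> bounds \<open>(mu - lam) \<langle>b - y', y'\<rangle>\<close> by
  \<open>mu \<langle>b - y', y' - y\<rangle>\<close>, and \<open>\<langle>b - y', y'\<rangle>\<close> is bounded below by the preceding lemma. Then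
  \<open>certificate_increment\<close> turns speed into growth of the norm.\<close>

lemma certificate_growth:
  fixes A :: "real^'n^'m"
  assumes p: "gauge_function p" and l: "0 < lam" and m: "lam < mu" and nu: "mu < \<nu>"
    and cert: "certificate A b p lam y u x" and cert': "certificate A b p mu y' u' x'"
    and w: "w \<in> subdifferential p 0" and b: "transpose A *v b = \<nu> *\<^sub>R w"
    and k: "0 \<le> \<kappa>" "\<kappa> * \<nu> \<le> norm (b - y')"
  shows "lam * \<kappa>\<^sup>2 * (mu - lam) \<le> norm b * (norm y' - norm y)"
proof -
  define \<delta> where "\<delta> = y' - y"
  have "(mu - lam) * \<kappa> \<le> norm \<delta>"
  proof (cases "b = y'")
    case True
    then have "\<kappa> = 0" using k l m nu by (simp add: mult_le_0_iff)
    then show ?thesis by simp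
  next
    case False
    define R where "R = norm (b - y')"
    have R: "0 < R" using False by (simp add: R_def)
    have "mu * ((b - y') \<bullet> y) \<le> lam * ((b - y') \<bullet> y')"
      by (rule certificate_variational[OF p cert', where w = u])
        (use l m cert in \<open>auto simp: certificate_def\<close>)
    then have 1: "(mu - lam) * ((b - y') \<bullet> y') \<le> mu * ((b - y') \<bullet> \<delta>)"
      by (simp add: \<delta>_def inner_diff_right algebra_simps)
    have 2: "mu * R\<^sup>2 \<le> \<nu> * ((b - y') \<bullet> y')"
      unfolding R_def by (rule certificate_inner_lower[OF p _ nu cert' w b]) (use l m in auto)
    have "mu * R * ((mu - lam) * R) = (mu - lam) * (mu * R\<^sup>2)"
      by (simp add: power2_eq_square algebra_simps)
    also have "\<dots> \<le> (mu - lam) * (\<nu> * ((b - y') \<bullet> y'))"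
      using 2 m by (intro mult_left_mono) auto
    also have "\<dots> = \<nu> * ((mu - lam) * ((b - y') \<bullet> y'))" by simp
    also have "\<dots> \<le> \<nu> * (mu * ((b - y') \<bullet> \<delta>))"
      using 1 l m nu by (intro mult_left_mono) auto
    also have "\<dots> \<le> \<nu> * (mu * (R * norm \<delta>))"
      unfolding R_def using l m nu by (intro mult_left_mono norm_cauchy_schwarz) auto
    also have "\<dots> = mu * R * (\<nu> * norm \<delta>)" by simp
    finally have 3: "(mu - lam) * R \<le> \<nu> * norm \<delta>" using R l m by simp
    have "\<nu> * ((mu - lam) * \<kappa>) = (mu - lam) * (\<kappa> * \<nu>)" by simp
    also have "\<dots> \<le> (mu - lam) * R" unfolding R_def using k m by (intro mult_left_mono) auto
    finally have "\<nu> * ((mu - lam) * \<kappa>) \<le> \<nu> * norm \<delta>" using 3 by linarith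
    then show ?thesis using l m nu by simp
  qed
  then have "((mu - lam) * \<kappa>)\<^sup>2 \<le> (norm \<delta>)\<^sup>2"
    using k m by (intro power_mono) auto
  then have "lam * ((mu - lam) * \<kappa>)\<^sup>2 \<le> lam * (norm \<delta>)\<^sup>2" using l by simp
  also have "\<dots> \<le> (mu - lam) * (\<delta> \<bullet> y)"
    unfolding \<delta>_def by (rule certificate_increment[OF p l m cert cert'])
  finally have "(mu - lam) * (lam * \<kappa>\<^sup>2 * (mu - lam)) \<le> (mu - lam) * (\<delta> \<bullet> y)"
    by (simp add: power2_eq_square algebra_simps)
  then have main: "lam * \<kappa>\<^sup>2 * (mu - lam) \<le> \<delta> \<bullet> y" using m by simp
  have 4: "0 \<le> lam * \<kappa>\<^sup>2 * (mu - lam)" using l m by simp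
  have "\<delta> \<bullet> y = y' \<bullet> y - norm y * norm y"
    by (simp add: \<delta>_def inner_diff_left power2_norm_eq_inner[symmetric] power2_eq_square)
  also have "\<dots> \<le> norm y' * norm y - norm y * norm y" by (simp add: norm_cauchy_schwarz)
  also have "\<dots> = norm y * (norm y' - norm y)" by (simp add: algebra_simps)
  finally have 5: "\<delta> \<bullet> y \<le> norm y * (norm y' - norm y)" .
  show ?thesis
  proof (cases "y = 0")
    case True
    then have "\<delta> \<bullet> y = 0" "0 \<le> norm b * (norm y' - norm y)" by simp_all
    then show ?thesis using main by linarith
  next
    case False
    have "0 \<le> norm y * (norm y' - norm y)" using main 4 5 by linarith
    then have "0 \<le> norm y' - norm y" using False by (simp add: zero_le_mult_iff)
    then have "norm y * (norm y' - norm y) \<le> norm b * (norm y' - norm y)"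
      using certificate_norm_le[OF p cert] l by (intro mult_right_mono) auto
    then show ?thesis using main 5 by linarith
  qed
qed

lemma derivative_ge_of_right_increments:
  fixes f :: "real \<Rightarrow> real"
  assumes D: "(f has_real_derivative D) (at s)" and "s < t"
    and inc: "\<And>r. s < r \<Longrightarrow> r < t \<Longrightarrow> c * (r - s) \<le> f r - f s"
  shows "c \<le> D"
proof (rule ccontr)
  assume "\<not> c \<le> D"
  then have neg: "D - c < 0" by simp
  have "((\<lambda>r. f r - c * r) has_real_derivative D - c) (at s)"
    using D by (auto intro!: derivative_eq_intros)
  from DERIV_neg_dec_right[OF this neg] obtain e where
    e: "0 < e" "\<And>h. 0 < h \<Longrightarrow> h < e \<Longrightarrow> f (s + h) - c * (s + h) < f s - c * s" by auto
  define h where "h = min (e / 2) ((t - s) / 2)"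
  have h: "0 < h" "h < e" "s + h < t" using e(1) \<open>s < t\<close> by (auto simp: h_def min_def field_simps)
  show False using e(2)[OF h(1,2)] inc[of "s + h"] h by (simp add: algebra_simps)
qed

lemma clarke_jacobian_ge:
  fixes f :: "real \<Rightarrow> real"
  assumes t: "a < t" "t < T"
    and inc: "\<And>s r. a < s \<Longrightarrow> s < r \<Longrightarrow> r < T \<Longrightarrow> c * (r - s) \<le> f r - f s"
    and v: "v \<in> clarke_jacobian f t"
  shows "c \<le> v"
proof -
  have "{v. \<exists>s d. s \<longlonglongrightarrow> t \<and> (\<forall>j. (f has_real_derivative d j) (at (s j))) \<and> d \<longlonglongrightarrow> v} \<subseteq> {c..}"
  proof clarsimp
    fix w s d
    assume s: "s \<longlonglongrightarrow> t" and D: "\<forall>j. (f has_real_derivative d j) (at (s j))" and w: "d \<longlonglongrightarrow> w"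
    have "\<forall>\<^sub>F j in sequentially. c \<le> d j"
      using order_tendstoD(1)[OF s t(1)] order_tendstoD(2)[OF s t(2)]
    proof eventually_elim
      case (elim j)
      show ?case
        by (rule derivative_ge_of_right_increments[OF D[rule_format] elim(2)])
          (use inc elim in auto)
    qed
    then show "c \<le> w" using w by (intro tendsto_lowerbound[of d w]) auto
  qed
  then have "clarke_jacobian f t \<subseteq> {c..}"
    unfolding clarke_jacobian_def by (rule hull_minimal) (rule convex_real_interval)
  then show ?thesis using v by auto
qed

section \<open>Affine pieces indexed by faces of the epigraph\<close>

text \<open>For \<open>u \<in> \<partial>p(0)\<close>, the linear function \<open>z \<mapsto> \<langle>u, z\<rangle>\<close> is a minorant of \<open>p\<close>; the contact
  face is the part of the epigraph of \<open>p\<close> that lies on the graph of this minorant.\<close>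

definition contact_face :: "('a::euclidean_space \<Rightarrow> ereal) \<Rightarrow> 'a \<Rightarrow> ('a \<times> real) set" where
  "contact_face p u = ereal_epigraph p \<inter> {e. (- u, 1) \<bullet> e = 0}"

lemma contact_face_face_of:
  assumes "gauge_function p" and "u \<in> subdifferential p 0"
  shows "contact_face p u face_of ereal_epigraph p"
  unfolding contact_face_def
proof (rule face_of_Int_supporting_hyperplane_ge)
  show "convex (ereal_epigraph p)" using assms(1) by (simp add: gauge_function_def)
  fix e assume "e \<in> ereal_epigraph p"
  then have "p (fst e) \<le> ereal (snd e)" by (auto simp: ereal_epigraph_def)
  moreover have "ereal (u \<bullet> fst e) \<le> p (fst e)"
    using assms subdifferential_gauge_0 by blast
  ultimately have "ereal (u \<bullet> fst e) \<le> ereal (snd e)"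
    by (meson order_trans)
  then show "0 \<le> (- u, 1) \<bullet> e" by (simp add: inner_prod_def)
qed

lemma certificate_contact:
  assumes "certificate A b p lam y u x" and "contact_face p u = contact_face p u'"
  shows "u' \<bullet> x = u \<bullet> x"
proof -
  have "(x, u \<bullet> x) \<in> contact_face p u"
    using assms(1) by (simp add: certificate_def contact_face_def ereal_epigraph_def)
  then show ?thesis unfolding assms(2) by (simp add: contact_face_def)
qed

text \<open>The primal points of certificates with a common contact face pair equally with all their
  subgradients. Hence the defect \<open>z\<close> of the affine relation satisfies
  \<open>\<parallel>z\<parallel>\<^sup>2 = \<langle>A\<^sup>T z, h\<rangle> = ((1 - t) l1 + t l2 - l3) \<langle>u1, h\<rangle> = 0\<close>, where \<open>h\<close> is the defect of the primal
  points. The parameter \<open>t\<close> need not lie in the unit interval.\<close>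

lemma certificate_affine:
  fixes A :: "real^'n^'m"
  assumes c1: "certificate A b p l1 y1 u1 x1" and c2: "certificate A b p l2 y2 u2 x2"
    and c3: "certificate A b p l3 y3 u3 x3" and l3: "l3 = (1 - t) * l1 + t * l2"
    and f: "contact_face p u1 = contact_face p u2" "contact_face p u1 = contact_face p u3"
  shows "y3 = (1 - t) *\<^sub>R y1 + t *\<^sub>R y2"
proof -
  define z where "z = (1 - t) *\<^sub>R y1 + t *\<^sub>R y2 - y3"
  define h where "h = x3 - (1 - t) *\<^sub>R x1 - t *\<^sub>R x2"
  have y: "y1 = b - A *v x1" "y2 = b - A *v x2" "y3 = b - A *v x3"
    using c1 c2 c3 unfolding certificate_def by blast+
  have Ah: "A *v h = A *v x3 - (1 - t) *\<^sub>R (A *v x1) - t *\<^sub>R (A *v x2)"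
    by (simp add: h_def matrix_vector_mult_diff_distrib matrix_vector_mult_scaleR)
  have z: "z = A *v h"
    unfolding z_def Ah y by (simp add: algebra_simps)
  have Az: "transpose A *v z = ((1 - t) * l1) *\<^sub>R u1 + (t * l2) *\<^sub>R u2 - l3 *\<^sub>R u3"
  proof -
    have "transpose A *v y1 = l1 *\<^sub>R u1" "transpose A *v y2 = l2 *\<^sub>R u2"
      "transpose A *v y3 = l3 *\<^sub>R u3"
      using c1 c2 c3 unfolding certificate_def by blast+
    then show ?thesis
      by (simp add: z_def matrix_vector_mult_diff_distrib matrix_vector_right_distrib
          matrix_vector_mult_scaleR del: transpose_matrix_vector)
  qed
  have "u2 \<bullet> h = u1 \<bullet> h" "u3 \<bullet> h = u1 \<bullet> h"
    using certificate_contact[OF c1, of u2] certificate_contact[OF c1, of u3]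
      certificate_contact[OF c2, of u1] certificate_contact[OF c2, of u3]
      certificate_contact[OF c3, of u1] certificate_contact[OF c3, of u2] f
    by (simp_all add: h_def inner_diff_right)
  then have "(transpose A *v z) \<bullet> h = ((1 - t) * l1 + t * l2 - l3) * (u1 \<bullet> h)"
    unfolding Az by (simp add: inner_diff_left inner_add_left algebra_simps)
  then have "(transpose A *v z) \<bullet> h = 0" by (simp add: l3)
  then have "z \<bullet> z = 0" using dot_lmul_matrix[of z A h] z by simp
  then show ?thesis by (simp add: z_def)
qed

lemma certificate_affine_piece:
  fixes A :: "real^'n^'m"
  assumes cert: "\<And>l. 0 < l \<Longrightarrow> certificate A b p l (Y l) (U l) (X l)"
  shows "\<exists>c d. \<forall>l>0. contact_face p (U l) = F \<longrightarrow> Y l = c + l *\<^sub>R d"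
proof (cases "\<exists>l1 l2. 0 < l1 \<and> 0 < l2 \<and> l1 \<noteq> l2 \<and> contact_face p (U l1) = F \<and> contact_face p (U l2) = F")
  case True
  then obtain l1 l2 where l: "0 < l1" "0 < l2" "l1 \<noteq> l2"
    "contact_face p (U l1) = F" "contact_face p (U l2) = F" by blast
  define d where "d = (1 / (l2 - l1)) *\<^sub>R (Y l2 - Y l1)"
  have "Y l = (Y l1 - l1 *\<^sub>R d) + l *\<^sub>R d" if "0 < l" "contact_face p (U l) = F" for l
  proof -
    define t where "t = (l - l1) / (l2 - l1)"
    have "t * (l2 - l1) = l - l1" using l(3) by (simp add: t_def)
    then have lt: "l = (1 - t) * l1 + t * l2" by (simp add: algebra_simps)
    have "Y l = (1 - t) *\<^sub>R Y l1 + t *\<^sub>R Y l2"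
      by (rule certificate_affine[OF cert[OF l(1)] cert[OF l(2)] cert[OF that(1)] lt])
        (use l that in auto)
    also have "\<dots> = Y l1 + t *\<^sub>R (Y l2 - Y l1)" by (simp add: algebra_simps)
    also have "t *\<^sub>R (Y l2 - Y l1) = (l - l1) *\<^sub>R d" by (simp add: t_def d_def)
    finally show ?thesis by (simp add: algebra_simps)
  qed
  then show ?thesis by blast
next
  case False
  show ?thesis
  proof (cases "\<exists>l0>0. contact_face p (U l0) = F")
    case True
    then obtain l0 where "0 < l0" "contact_face p (U l0) = F" by blast
    then have "\<forall>l>0. contact_face p (U l) = F \<longrightarrow> Y l = Y l0 + l *\<^sub>R 0"
      using False by (metis add.right_neutral scaleR_zero_right)
    then show ?thesis by blast
  qed blast
qed

text \<open>A piece that vanishes at \<open>t0\<close> may fail to be differentiable there, but by continuity it stays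
  below \<open>f\<close> near \<open>t0\<close> and can be discarded.\<close>

lemma piecewise_Ck_norm_of_finite_affine_pieces:
  fixes c d :: "'i \<Rightarrow> 'a::real_inner"
  assumes I: "finite I" and T: "open T" "t0 \<in> T"
    and cont: "continuous_on T f" and pos: "0 < f t0"
    and pieces: "\<And>t. t \<in> T \<Longrightarrow> \<exists>i\<in>I. f t = norm (c i + t *\<^sub>R d i)"
  shows "\<exists>\<alpha> \<beta>. \<alpha> < t0 \<and> t0 < \<beta> \<and> {\<alpha><..<\<beta>} \<subseteq> T \<and> piecewise_Ck_on k f {\<alpha><..<\<beta>}"
proof -
  have f: "(f \<longlongrightarrow> f t0) (nhds t0)"
    using cont T by (simp add: continuous_on_eq_continuous_at tendsto_nhds_iff isCont_def)
  have g: "((\<lambda>t. norm (c i + t *\<^sub>R d i)) \<longlongrightarrow> norm (c i + t0 *\<^sub>R d i)) (nhds t0)" for i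
  proof -
    have "isCont (\<lambda>t. norm (c i + t *\<^sub>R d i)) t0" by (intro continuous_intros)
    then show ?thesis by (simp add: tendsto_nhds_iff isCont_def)
  qed
  \<comment> \<open>The index is good if its piece does not vanish at \<open>t0\<close>.\<close>
  define good where "good i \<longleftrightarrow> c i + t0 *\<^sub>R d i \<noteq> 0" for i
  have "\<forall>\<^sub>F t in nhds t0. if good i then c i + t *\<^sub>R d i \<noteq> 0 else norm (c i + t *\<^sub>R d i) < f t" for i
  proof (cases "good i")
    case True
    then have "0 < norm (c i + t0 *\<^sub>R d i)" by (simp add: good_def)
    from order_tendstoD(1)[OF g this] show ?thesis using True by simp
  next
    case False
    then have "((\<lambda>t. f t - norm (c i + t *\<^sub>R d i)) \<longlongrightarrow> f t0 - 0) (nhds t0)"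
      using tendsto_diff[OF f g[of i]] by (simp add: good_def)
    from order_tendstoD(1)[OF this, of 0] show ?thesis using False pos by simp
  qed
  then have "\<forall>\<^sub>F t in nhds t0. \<forall>i\<in>I. if good i then c i + t *\<^sub>R d i \<noteq> 0 else norm (c i + t *\<^sub>R d i) < f t"
    by (simp add: eventually_ball_finite_distrib[OF I])
  moreover have "\<forall>\<^sub>F t in nhds t0. t \<in> T" using T by (rule eventually_nhds_in_open)
  ultimately have "\<forall>\<^sub>F t in nhds t0. t \<in> T \<and>
      (\<forall>i\<in>I. if good i then c i + t *\<^sub>R d i \<noteq> 0 else norm (c i + t *\<^sub>R d i) < f t)"
    by (rule eventually_elim2) auto
  then obtain e where e: "0 < e" "\<And>t. dist t t0 < e \<Longrightarrow> t \<in> T \<and>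
      (\<forall>i\<in>I. if good i then c i + t *\<^sub>R d i \<noteq> 0 else norm (c i + t *\<^sub>R d i) < f t)"
    unfolding eventually_nhds_metric by blast
  define S where "S = {t0 - e<..<t0 + e}"
  have S: "t \<in> T" "\<And>i. i \<in> I \<Longrightarrow> if good i then c i + t *\<^sub>R d i \<noteq> 0 else norm (c i + t *\<^sub>R d i) < f t"
    if "t \<in> S" for t
    using e(2)[of t] that by (auto simp: S_def dist_real_def abs_less_iff)
  have "piecewise_Ck_on k f S"
    unfolding piecewise_Ck_on_def
  proof (intro conjI exI[of _ "(\<lambda>i t. norm (c i + t *\<^sub>R d i)) ` {i\<in>I. good i}"])
    show "continuous_on S f" using cont S(1) by (blast intro: continuous_on_subset)
    show "finite ((\<lambda>i t. norm (c i + t *\<^sub>R d i)) ` {i\<in>I. good i})" using I by simp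
    show "\<forall>g\<in>(\<lambda>i t. norm (c i + t *\<^sub>R d i)) ` {i\<in>I. good i}. Ck_on k g S"
    proof clarify
      fix i assume "i \<in> I" "good i"
      then have "\<And>t. t \<in> S \<Longrightarrow> c i + t *\<^sub>R d i \<noteq> 0" using S(2) by metis
      then show "Ck_on k (\<lambda>t. norm (c i + t *\<^sub>R d i)) S"
        by (intro Ck_on_norm_affine) (simp_all add: S_def)
    qed
    show "\<forall>t\<in>S. \<exists>g\<in>(\<lambda>i t. norm (c i + t *\<^sub>R d i)) ` {i\<in>I. good i}. f t = g t"
    proof
      fix t assume t: "t \<in> S"
      obtain i where i: "i \<in> I" "f t = norm (c i + t *\<^sub>R d i)" using pieces S(1)[OF t] by blast
      then have "good i" using S(2)[OF t i(1)] by (auto split: if_splits)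
      then show "\<exists>g\<in>(\<lambda>i t. norm (c i + t *\<^sub>R d i)) ` {i\<in>I. good i}. f t = g t"
        using i by (intro bexI[of _ "\<lambda>t. norm (c i + t *\<^sub>R d i)"]) auto
    qed
  qed
  then show ?thesis using e(1) S(1)
    by (intro exI[of _ "t0 - e"] exI[of _ "t0 + e"]) (auto simp: S_def)
qed

section \<open>The value function\<close>

theorem theorem4p2:
  fixes A :: "real^'n^'m" and b :: "real^'m" and p :: "real^'n \<Rightarrow> ereal"
    and lambda_bar :: real
  assumes "gauge_function p" and "polyhedral p"
    and standing: "\<And>lam::real. 0 < lam \<Longrightarrow>
      \<exists>(y::real^'m) (u::real^'n) (x::real^'n).
        x \<in> subdifferential (fenchel_conjugate p) u \<and>
        y - b + A *v x = 0 \<and>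
        transpose A *v y - lam *\<^sub>R u = 0"
    and "0 < lambda_inf A b p" and "lambda_inf A b p < \<infinity>"
    and "0 < lambda_bar" and "ereal lambda_bar < lambda_inf A b p"
  shows "(\<forall>k::nat. 1 \<le> k \<longrightarrow>
            (\<exists>\<alpha> \<beta>. 0 \<le> \<alpha> \<and> \<alpha> < lambda_bar \<and> lambda_bar < \<beta> \<and>
                   piecewise_Ck_on k (value_function A b p) {\<alpha><..<\<beta>})) \<and>
         (\<forall>v \<in> clarke_jacobian (value_function A b p) lambda_bar. 0 < v)"
proof -
  note p = assms(1)
  let ?\<phi> = "value_function A b p"
  have "\<exists>y u x. certificate A b p l y u x" if "0 < l" for l
    using standing[OF that] certificate_of_optimality_system[OF assms(1,2)] by meson
  then obtain Y U X where cert: "\<And>l. 0 < l \<Longrightarrow> certificate A b p l (Y l) (U l) (X l)"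
    by metis
  have val: "?\<phi> l = norm (Y l)" if "0 < l" for l
    by (rule certificate_value[OF p that cert[OF that]])
  have not_attained: "\<not> (0 \<le> \<nu> \<and> transpose A *v b \<in> (\<lambda>v. \<nu> *\<^sub>R v) ` subdifferential p 0)"
    if "ereal \<nu> < lambda_inf A b p" for \<nu>
    using that unfolding lambda_inf_def
    by (metis (mono_tags, lifting) Inf_lower image_eqI linorder_not_le mem_Collect_eq)
  obtain \<nu> w where nu: "0 \<le> \<nu>" "transpose A *v b = \<nu> *\<^sub>R w" "w \<in> subdifferential p 0"
  proof -
    let ?N = "{\<nu>. 0 \<le> \<nu> \<and> transpose A *v b \<in> (\<lambda>v. \<nu> *\<^sub>R v) ` subdifferential p 0}"
    have "?N \<noteq> {}"
    proof
      assume "?N = {}"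
      then have "lambda_inf A b p = \<infinity>"
        unfolding lambda_inf_def by (simp only: image_empty Inf_empty top_ereal_def)
      then show False using assms(5) by simp
    qed
    then show thesis using that by blast
  qed
  have below: "l < \<nu>" if "ereal l < lambda_inf A b p" for l
  proof -
    have "lambda_inf A b p \<le> ereal \<nu>"
    proof (rule leI, rule notI)
      assume "ereal \<nu> < lambda_inf A b p"
      moreover have "transpose A *v b \<in> (\<lambda>v. \<nu> *\<^sub>R v) ` subdifferential p 0"
        using nu(2,3) by (rule image_eqI)
      ultimately show False using not_attained nu(1) by blast
    qed
    then show ?thesis using that by (metis ereal_less(2) less_ereal.simps(1) order_less_le_trans)
  qed
  have distinct: "Y l \<noteq> b" if "0 < l" "ereal l < lambda_inf A b p" for l
  proof
    assume "Y l = b"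
    then have "transpose A *v b = l *\<^sub>R U l" "U l \<in> subdifferential p 0"
      using cert[OF that(1)] by (auto simp: certificate_def)
    then show False using not_attained[OF that(2)] that(1) by auto
  qed
  have pos: "0 < ?\<phi> l" if "0 < l" "ereal l < lambda_inf A b p" for l
  proof -
    have "0 < l * (norm (b - Y l))\<^sup>2" using distinct[OF that] that(1) by auto
    also have "\<dots> \<le> \<nu> * ((b - Y l) \<bullet> Y l)"
      by (rule certificate_inner_lower[OF p that(1) below[OF that(2)] cert[OF that(1)] nu(3,2)])
    finally have "Y l \<noteq> 0" by auto
    then show ?thesis by (simp add: val[OF that(1)])
  qed
  \<comment> \<open>Half of the base point serves as a positive lower bound for the parameters: the Lipschitz
    constant and the growth rate both degenerate at \<open>0\<close>.\<close>
  have lip: "\<bar>?\<phi> r - ?\<phi> s\<bar> \<le> norm b / (lambda_bar / 2) * \<bar>r - s\<bar>"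
    if "lambda_bar / 2 < s" "s < r" for s r
  proof -
    have s: "0 < s" "0 < r" using that assms(6) by auto
    have "lambda_bar / 2 * \<bar>?\<phi> r - ?\<phi> s\<bar> \<le> s * norm (Y r - Y s)"
      unfolding val[OF s(1)] val[OF s(2)]
      using that assms(6) by (intro mult_mono norm_triangle_ineq3) auto
    also have "\<dots> \<le> norm b * (r - s)"
      by (rule certificate_lipschitz[OF p s(1) that(2) cert[OF s(1)] cert[OF s(2)]])
    finally show ?thesis using that assms(6) by (simp add: field_simps)
  qed
  have "(norm b / (lambda_bar / 2))-lipschitz_on {lambda_bar / 2<..} ?\<phi>"
  proof (rule lipschitz_onI)
    fix s r assume "s \<in> {lambda_bar / 2<..}" "r \<in> {lambda_bar / 2<..}"
    then show "dist (?\<phi> s) (?\<phi> r) \<le> norm b / (lambda_bar / 2) * dist s r"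
      using lip[of s r] lip[of r s]
      by (cases s r rule: linorder_cases) (auto simp: dist_real_def abs_minus_commute)
  qed (use assms(6) in auto)
  then have cont: "continuous_on {lambda_bar / 2<..} ?\<phi>"
    by (rule lipschitz_on_continuous_on)
  have "finite {F. F face_of ereal_epigraph p}"
    using assms(2) unfolding polyhedral_def by (rule finite_polyhedron_faces)
  moreover have face: "contact_face p (U l) \<in> {F. F face_of ereal_epigraph p}" if "0 < l" for l
    using contact_face_face_of[OF p] cert[OF that] by (simp add: certificate_def)
  moreover obtain c d where cd: "\<And>F l. 0 < l \<Longrightarrow> contact_face p (U l) = F \<Longrightarrow> Y l = c F + l *\<^sub>R d F"
    using certificate_affine_piece[OF cert] by metis
  ultimately have smooth: "\<exists>\<alpha> \<beta>. \<alpha> < lambda_bar \<and> lambda_bar < \<beta> \<and> {\<alpha><..<\<beta>} \<subseteq> {lambda_bar / 2<..} \<and>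
      piecewise_Ck_on k ?\<phi> {\<alpha><..<\<beta>}" for k
  proof (intro piecewise_Ck_norm_of_finite_affine_pieces[where c = c and d = d])
    fix t assume "t \<in> {lambda_bar / 2<..}"
    then have t: "0 < t" using assms(6) by simp
    show "\<exists>F\<in>{F. F face_of ereal_epigraph p}. ?\<phi> t = norm (c F + t *\<^sub>R d F)"
      using face[OF t] cd[OF t refl] val[OF t] by metis
  qed (use cont pos assms(6,7) in auto)
  have part1: "\<exists>\<alpha> \<beta>. 0 \<le> \<alpha> \<and> \<alpha> < lambda_bar \<and> lambda_bar < \<beta> \<and>
      piecewise_Ck_on k ?\<phi> {\<alpha><..<\<beta>}" for k
  proof -
    obtain \<alpha> \<beta> where ab: "\<alpha> < lambda_bar" "lambda_bar < \<beta>" "{\<alpha><..<\<beta>} \<subseteq> {lambda_bar / 2<..}"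
      "piecewise_Ck_on k ?\<phi> {\<alpha><..<\<beta>}" using smooth by blast
    have "0 \<le> \<alpha>"
    proof (rule ccontr)
      assume "\<not> 0 \<le> \<alpha>"
      then have "lambda_bar / 4 \<in> {\<alpha><..<\<beta>}" using ab(2) assms(6) by simp
      then have "lambda_bar / 4 \<in> {lambda_bar / 2<..}" using ab(3) by blast
      then show False using assms(6) by simp
    qed
    then show ?thesis using ab assms(6) by (intro exI[of _ \<alpha>] exI[of _ \<beta>]) auto
  qed
  obtain L where L: "lambda_bar < L" "ereal L < lambda_inf A b p"
    using ereal_dense2[OF assms(7)] by auto
  have L0: "0 < L" using L assms(6) by simp
  \<comment> \<open>The distance of \<open>b\<close> to the residual decreases in the parameter, so its value at \<open>L\<close> bounds it
    from below on the whole interval up to \<open>L\<close>.\<close>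
  define \<kappa> where "\<kappa> = norm (b - Y L) / \<nu>"
  have nu0: "0 < \<nu>" using below[OF L(2)] L0 by simp
  have \<kappa>: "0 < \<kappa>" using distinct[OF L0 L(2)] nu0 by (auto simp: \<kappa>_def)
  have b: "b \<noteq> 0"
    using certificate_norm_le[OF p cert[OF L0]] pos[OF L0 L(2)] val[OF L0] L0 by auto
  define \<gamma> where "\<gamma> = lambda_bar / 2 * \<kappa>\<^sup>2 / norm b"
  have \<gamma>: "0 < \<gamma>" using \<kappa> b assms(6) by (simp add: \<gamma>_def)
  have inc: "\<gamma> * (r - s) \<le> ?\<phi> r - ?\<phi> s" if "lambda_bar / 2 < s" "s < r" "r < L" for s r
  proof -
    have s: "0 < s" "0 < r" using that assms(6) by auto
    have r: "r < \<nu>" using below[OF L(2)] that by simp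
    have "\<kappa> * \<nu> \<le> norm (b - Y r)"
      using certificate_distance_antimono[OF p s(2) that(3) cert[OF s(2)] cert[OF L0]] nu0
      by (simp add: \<kappa>_def)
    then have "s * \<kappa>\<^sup>2 * (r - s) \<le> norm b * (?\<phi> r - ?\<phi> s)"
      using certificate_growth[OF p s(1) that(2) r cert[OF s(1)] cert[OF s(2)] nu(3,2)] \<kappa>
      by (simp add: val s)
    moreover have "lambda_bar / 2 * \<kappa>\<^sup>2 * (r - s) \<le> s * \<kappa>\<^sup>2 * (r - s)"
      using that by (intro mult_right_mono) auto
    ultimately have "lambda_bar / 2 * \<kappa>\<^sup>2 * (r - s) \<le> norm b * (?\<phi> r - ?\<phi> s)" by linarith
    then show ?thesis using b by (simp add: \<gamma>_def field_simps)
  qed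
  have "\<gamma> \<le> v" if "v \<in> clarke_jacobian ?\<phi> lambda_bar" for v
    by (rule clarke_jacobian_ge[where a = "lambda_bar / 2", OF _ L(1) inc that]) (use assms(6) in auto)
  then show ?thesis using part1 \<gamma> by fastforce
qed

end
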